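(* Let $\mathcal{A}$ be a uniform algebra, and let $\alpha: \mathcal{A} \to \mathcal{A}$ be an anti-linear complete contraction whose range is contained in the scalar multiples of the identity, $\mathbb{C} 1 \subset \mathcal{A}$ (it is not assumed that $\alpha(1) = 1$). Let $n \in \mathbb{N}$ and let $\theta: \mathcal{A} \to \mathcal{M}_n(\mathbb{C})$ be a continuous unital algebra homomorphism that is completely bounded. Define the linear map $$\Lambda: \mathcal{A} \to \mathcal{M}_n(\mathbb{C}), \quad \Lambda(f) = \theta(f) + \theta(\alpha(f))^*.$$ If $\|\Lambda\|_{cb} \le 2$, then $\|\theta\|_{cb} \le 2$.
   Context: A uniform algebra is a norm-closed subalgebra of $C(X)$ ($X$ compact Hausdorff, supremum norm) that contains the constants and separates the points of $X$. The space $\mathcal{M}_N(\mathcal{A})$ of $N \times N$ matrices over $\mathcal{A}$ is normed by $\|[f_{ij}]\| = \sup_{x \in X} \|[f_{ij}(x)]\|_{\mathcal{M}_N(\mathbb{C})}$, where $\mathcal{M}_N(\mathbb{C})$ has the operator norm on $\mathbb{C}^N$; $\mathcal{M}_N(\mathcal{M}_n(\mathbb{C}))$ is identified with $\mathcal{M}_{Nn}(\mathbb{C})$ with its operator norm. For a linear or anti-linear map $\varphi$ between such algebras, $\varphi^{(N)}$ is the map on $N \times N$ matrices obtained by applying $\varphi$ entrywise, $\|\varphi^{(N)}\|$ is the supremum of $\|\varphi^{(N)}(F)\|$ over $\|F\| \le 1$, and $\|\varphi\|_{cb} = \sup_{N \in \mathbb{N}} \|\varphi^{(N)}\|$. The map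 $\varphi$ is completely bounded if $\|\varphi\|_{cb} < \infty$ and a complete contraction if $\|\varphi\|_{cb} \le 1$. *)

theory Defs
  imports "HOL-Analysis.Analysis"
begin

subsection \<open>Pointwise multiplication of bounded continuous functions\<close>

text \<open>
  The library makes the bounded continuous functions a normed vector space under the supremum
  norm; here they become a normed algebra. On a compact space they are all of \<open>C(X)\<close>.
\<close>

instantiation bcontfun :: (topological_space, "{real_normed_algebra_1, comm_ring_1}")
  "{real_normed_algebra_1, comm_ring_1}"
begin

definition times_bcontfun :: "('a \<Rightarrow>\<^sub>C 'b) \<Rightarrow> ('a \<Rightarrow>\<^sub>C 'b) \<Rightarrow> 'a \<Rightarrow>\<^sub>C 'b" where
  "times_bcontfun f g = Bcontfun (\<lambda>x. apply_bcontfun f x * apply_bcontfun g x)"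

definition one_bcontfun :: "'a \<Rightarrow>\<^sub>C 'b" where
  "one_bcontfun = const_bcontfun 1"

lemma apply_bcontfun_times [simp]:
  "apply_bcontfun (f * g) x = apply_bcontfun f x * apply_bcontfun g x"
proof -
  have "norm (apply_bcontfun f x * apply_bcontfun g x) \<le> norm f * norm g" for x
    by (rule order_trans[OF norm_mult_ineq]) (intro mult_mono norm_bounded norm_ge_zero)
  then have "(\<lambda>x. apply_bcontfun f x * apply_bcontfun g x) \<in> bcontfun"
    by (intro bcontfun_normI[where b = "norm f * norm g"] continuous_intros) auto
  then show ?thesis
    by (simp add: times_bcontfun_def Bcontfun_inverse)
qed

lemma apply_bcontfun_one [simp]: "apply_bcontfun 1 x = 1"
  by (simp add: one_bcontfun_def)

instance
proof
  fix f g h :: "'a \<Rightarrow>\<^sub>C 'b" and r :: real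
  show "f * g * h = f * (g * h)" "f * g = g * f" "1 * f = f" "f * 1 = f" "(f + g) * h = f * h + g * h"
    "f * (g + h) = f * g + f * h"
    "r *\<^sub>R f * g = r *\<^sub>R (f * g)" "f * r *\<^sub>R g = r *\<^sub>R (f * g)"
    by (rule bcontfun_eqI; simp add: algebra_simps)+
  have "apply_bcontfun (0 :: 'a \<Rightarrow>\<^sub>C 'b) undefined \<noteq> apply_bcontfun 1 undefined"
    by simp
  then show "(0 :: 'a \<Rightarrow>\<^sub>C 'b) \<noteq> 1"
    by metis
  show "norm (f * g) \<le> norm f * norm g"
    by (rule norm_bound, simp, rule order_trans[OF norm_mult_ineq])
      (intro mult_mono norm_bounded norm_ge_zero)
  have "norm (1 :: 'a \<Rightarrow>\<^sub>C 'b) \<le> 1"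
    by (rule norm_bound) simp
  moreover have "1 \<le> norm (1 :: 'a \<Rightarrow>\<^sub>C 'b)"
    using norm_bounded[of "1 :: 'a \<Rightarrow>\<^sub>C 'b" undefined] by simp
  ultimately show "norm (1 :: 'a \<Rightarrow>\<^sub>C 'b) = 1"
    by simp
qed

end


subsection \<open>Uniform algebras and maps on them\<close>

text \<open>
  The library has no class of complex vector spaces: the scalar multiple \<open>c f\<close> of a function is
  written as the product with a constant function, that of a matrix by mapping over its entries.
\<close>

definition uniform_algebra :: "('x::t2_space \<Rightarrow>\<^sub>C complex) set \<Rightarrow> bool" where
  "uniform_algebra A \<longleftrightarrow>
     compact (UNIV :: 'x set) \<and>
     closed A \<and>
     range const_bcontfun \<subseteq> A \<and>
     (\<forall>f\<in>A. \<forall>g\<in>A. f + g \<in> A) \<and>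
     (\<forall>f\<in>A. \<forall>g\<in>A. f * g \<in> A) \<and>
     (\<forall>c. \<forall>f\<in>A. const_bcontfun c * f \<in> A) \<and>
     (\<forall>x y. x \<noteq> y \<longrightarrow> (\<exists>f\<in>A. apply_bcontfun f x \<noteq> apply_bcontfun f y))"

definition antilinear_on ::
  "('x::topological_space \<Rightarrow>\<^sub>C complex) set \<Rightarrow> (('x \<Rightarrow>\<^sub>C complex) \<Rightarrow> 'x \<Rightarrow>\<^sub>C complex) \<Rightarrow> bool"
  where
  "antilinear_on A \<alpha> \<longleftrightarrow>
     (\<forall>f\<in>A. \<forall>g\<in>A. \<alpha> (f + g) = \<alpha> f + \<alpha> g) \<and>
     (\<forall>c. \<forall>f\<in>A. \<alpha> (const_bcontfun c * f) = const_bcontfun (cnj c) * \<alpha> f)"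

definition unital_algebra_hom_on ::
  "('x::topological_space \<Rightarrow>\<^sub>C complex) set \<Rightarrow> (('x \<Rightarrow>\<^sub>C complex) \<Rightarrow> complex^'n^'n) \<Rightarrow> bool"
  where
  "unital_algebra_hom_on A \<theta> \<longleftrightarrow>
     (\<forall>f\<in>A. \<forall>g\<in>A. \<theta> (f + g) = \<theta> f + \<theta> g) \<and>
     (\<forall>c. \<forall>f\<in>A. \<theta> (const_bcontfun c * f) = map_matrix (\<lambda>z. c * z) (\<theta> f)) \<and>
     (\<forall>f\<in>A. \<forall>g\<in>A. \<theta> (f * g) = \<theta> f ** \<theta> g) \<and>
     \<theta> 1 = mat 1"

definition conj_transpose :: "complex^'n^'m \<Rightarrow> complex^'m^'n" where
  "conj_transpose M = map_matrix cnj (transpose M)"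


subsection \<open>Matrix norms and the completely bounded norm\<close>

text \<open>
  An \<open>N \<times> N\<close> matrix is a function of two indices of which only the values at \<open>i, j < N\<close> matter.
  A block matrix \<open>T\<close> of operators on \<open>V\<close> acts on the Hilbert sum of \<open>N\<close> copies of \<open>V\<close>. For
  \<open>V = complex\<close> this is Euclidean \<open>N\<close>-space; for \<open>V = complex^'n\<close> it is Euclidean \<open>(N n)\<close>-space,
  which gives the identification of \<open>N \<times> N\<close> matrices over the \<open>n \<times> n\<close> matrices with
  \<open>N n \<times> N n\<close> matrices.
\<close>

definition block_op_norm :: "nat \<Rightarrow> (nat \<Rightarrow> nat \<Rightarrow> 'v \<Rightarrow> 'v::real_normed_vector) \<Rightarrow> real" where
  "block_op_norm N T =
     Sup {L2_set (\<lambda>i. norm (\<Sum>j<N. T i j (v j))) {..<N} | v.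
            L2_set (\<lambda>j. norm (v j)) {..<N} \<le> 1}"

definition fun_matrix_norm ::
  "nat \<Rightarrow> (nat \<Rightarrow> nat \<Rightarrow> ('x::topological_space \<Rightarrow>\<^sub>C complex)) \<Rightarrow> real" where
  "fun_matrix_norm N F = (SUP x. block_op_norm N (\<lambda>i j z. apply_bcontfun (F i j) x * z))"

definition mat_matrix_norm :: "nat \<Rightarrow> (nat \<Rightarrow> nat \<Rightarrow> complex^'n^'n) \<Rightarrow> real" where
  "mat_matrix_norm N M = block_op_norm N (\<lambda>i j z. M i j *v z)"

text \<open>
  The parameter \<open>\<nu>\<close> is the family of norms on the matrices over the target of \<open>\<phi>\<close>. Values are
  extended nonnegative reals, so that an unbounded \<open>\<phi>\<close> has norm \<open>\<infinity>\<close>.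
\<close>

definition amplification_norm ::
  "('x::topological_space \<Rightarrow>\<^sub>C complex) set \<Rightarrow> (nat \<Rightarrow> (nat \<Rightarrow> nat \<Rightarrow> 'b) \<Rightarrow> real) \<Rightarrow>
   (('x \<Rightarrow>\<^sub>C complex) \<Rightarrow> 'b) \<Rightarrow> nat \<Rightarrow> ennreal" where
  "amplification_norm A \<nu> \<phi> N =
     (SUP F \<in> {F. (\<forall>i<N. \<forall>j<N. F i j \<in> A) \<and> fun_matrix_norm N F \<le> 1}.
        ennreal (\<nu> N (\<lambda>i j. \<phi> (F i j))))"

definition cb_norm ::
  "('x::topological_space \<Rightarrow>\<^sub>C complex) set \<Rightarrow> (nat \<Rightarrow> (nat \<Rightarrow> nat \<Rightarrow> 'b) \<Rightarrow> real) \<Rightarrow>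
   (('x \<Rightarrow>\<^sub>C complex) \<Rightarrow> 'b) \<Rightarrow> ennreal" where
  "cb_norm A \<nu> \<phi> = (SUP N \<in> {1..}. amplification_norm A \<nu> \<phi> N)"

definition completely_bounded ::
  "('x::topological_space \<Rightarrow>\<^sub>C complex) set \<Rightarrow> (nat \<Rightarrow> (nat \<Rightarrow> nat \<Rightarrow> 'b) \<Rightarrow> real) \<Rightarrow>
   (('x \<Rightarrow>\<^sub>C complex) \<Rightarrow> 'b) \<Rightarrow> bool" where
  "completely_bounded A \<nu> \<phi> \<longleftrightarrow> cb_norm A \<nu> \<phi> < \<infinity>"

definition complete_contraction ::
  "('x::topological_space \<Rightarrow>\<^sub>C complex) set \<Rightarrow> (nat \<Rightarrow> (nat \<Rightarrow> nat \<Rightarrow> 'b) \<Rightarrow> real) \<Rightarrow>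
   (('x \<Rightarrow>\<^sub>C complex) \<Rightarrow> 'b) \<Rightarrow> bool" where
  "complete_contraction A \<nu> \<phi> \<longleftrightarrow> cb_norm A \<nu> \<phi> \<le> 1"

end

(*
  Since alpha takes values in the constants, Lambda(f) = theta(f) + phi(f) 1 for a scalar function
  phi. Fix N and let K be the norm of theta^(N). If a matrix F of norm at most 1, vectors x of norm
  at most 1 and u = theta^(N)(F) x almost attain K, then replacing F by its Moebius transform, to
  first order F + B - F B^* F with a small scalar matrix B, changes Re <theta^(N)(F) x, u> by about
  (1 - K^2) Re <B x, u>. This Moebius transform has norm at most 1 up to a second order term, so
  (1 - K^2) Re <B x, u> is almost nonpositive by extremality. With B a small positive multiple of
  phi^(N)(F) and K > 1 this makes Re <phi^(N)(F) x, u> almost nonnegative, and therefore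
  |u|^2 is almost bounded by Re <Lambda^(N)(F) x, u>, hence by 2 |u|; in the limit K <= 2.
*)

theory Submission
  imports Defs
begin

section \<open>Block vectors and block operators\<close>

definition block_apply :: "nat \<Rightarrow> (nat \<Rightarrow> nat \<Rightarrow> 'v \<Rightarrow> 'w) \<Rightarrow> (nat \<Rightarrow> 'v) \<Rightarrow> nat \<Rightarrow> 'w::comm_monoid_add"
  where "block_apply N T v = (\<lambda>i. \<Sum>j<N. T i j (v j))"

text \<open>Entries with index N or more are ignored, so this is only a seminorm on functions of
  \<open>nat\<close>, and identities between block vectors matter only at indices i < N.\<close>

definition block_norm :: "nat \<Rightarrow> (nat \<Rightarrow> 'v::real_normed_vector) \<Rightarrow> real"
  where "block_norm N v = L2_set (\<lambda>i. norm (v i)) {..<N}"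

text \<open>On complex spaces this is the real part of the Hermitian inner product, with the same
  norm and, for complex linear operators, the same adjoints. All real parts in the argument are thus
  built in.\<close>

definition block_inner :: "nat \<Rightarrow> (nat \<Rightarrow> 'v::real_inner) \<Rightarrow> (nat \<Rightarrow> 'v) \<Rightarrow> real"
  where "block_inner N v w = (\<Sum>i<N. v i \<bullet> w i)"

lemma block_norm_nonneg [simp]: "0 \<le> block_norm N v"
  by (simp add: block_norm_def)

lemma block_norm_power2: "(block_norm N v)\<^sup>2 = block_inner N v v"
  by (simp add: block_norm_def block_inner_def L2_set_def sum_nonneg power2_norm_eq_inner)

lemma block_inner_commute: "block_inner N v w = block_inner N w v"
  by (simp add: block_inner_def inner_commute)

lemma block_inner_linear [simp]:
  "block_inner N (\<lambda>i. u i + v i) w = block_inner N u w + block_inner N v w"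
  "block_inner N (\<lambda>i. u i - v i) w = block_inner N u w - block_inner N v w"
  "block_inner N (\<lambda>i. r *\<^sub>R u i) w = r * block_inner N u w"
  "block_inner N w (\<lambda>i. u i + v i) = block_inner N w u + block_inner N w v"
  "block_inner N w (\<lambda>i. u i - v i) = block_inner N w u - block_inner N w v"
  "block_inner N w (\<lambda>i. r *\<^sub>R u i) = r * block_inner N w u"
  by (simp_all add: block_inner_def inner_simps sum.distrib sum_subtractf sum_distrib_left)

lemma block_inner_Cauchy_Schwarz: "\<bar>block_inner N v w\<bar> \<le> block_norm N v * block_norm N w"
proof -
  have "\<bar>block_inner N v w\<bar> \<le> (\<Sum>i<N. \<bar>norm (v i)\<bar> * \<bar>norm (w i)\<bar>)"
    unfolding block_inner_def
    by (rule order_trans[OF sum_abs]) (simp add: sum_mono Cauchy_Schwarz_ineq2)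
  also have "\<dots> \<le> block_norm N v * block_norm N w"
    unfolding block_norm_def by (rule L2_set_mult_ineq)
  finally show ?thesis .
qed

lemma block_inner_adjoint:
  assumes "\<And>i j z w. i < N \<Longrightarrow> j < N \<Longrightarrow> T i j z \<bullet> w = z \<bullet> S j i w"
  shows "block_inner N (block_apply N T v) w = block_inner N v (block_apply N S w)"
proof -
  have "block_inner N (block_apply N T v) w = (\<Sum>i<N. \<Sum>j<N. v j \<bullet> S j i (w i))"
    by (simp add: block_inner_def block_apply_def inner_sum_left assms)
  also have "\<dots> = (\<Sum>j<N. \<Sum>i<N. v j \<bullet> S j i (w i))"
    by (rule sum.swap)
  finally show ?thesis
    by (simp add: block_inner_def block_apply_def inner_sum_right)
qed

lemma norm_le_block_norm: "i < N \<Longrightarrow> norm (v i) \<le> block_norm N v"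
  unfolding block_norm_def by (rule member_le_L2_set) auto

text \<open>Every component is at most N c |v|, and the l2 norm is at most the l1 norm. The crude
  constant is enough to make suprema finite and to control scalar perturbations that tend to
  0.\<close>

lemma block_norm_apply_le:
  assumes T: "\<And>i j z. i < N \<Longrightarrow> j < N \<Longrightarrow> norm (T i j z) \<le> c * norm z" and "0 \<le> c"
  shows "block_norm N (block_apply N T v) \<le> (real N)\<^sup>2 * c * block_norm N v"
proof -
  have "norm (block_apply N T v i) \<le> real N * (c * block_norm N v)" if "i < N" for i
  proof -
    have "norm (block_apply N T v i) \<le> (\<Sum>j<N. c * block_norm N v)"
      unfolding block_apply_def
    proof (rule sum_norm_le)
      fix j assume "j \<in> {..<N}"
      then have "norm (T i j (v j)) \<le> c * norm (v j)" "norm (v j) \<le> block_norm N v"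
        using T that norm_le_block_norm by auto
      then show "norm (T i j (v j)) \<le> c * block_norm N v"
        using \<open>0 \<le> c\<close> by (meson mult_left_mono order_trans)
    qed
    then show ?thesis by simp
  qed
  then have "(\<Sum>i<N. norm (block_apply N T v i)) \<le> (\<Sum>i<N. real N * (c * block_norm N v))"
    by (intro sum_mono) auto
  moreover have "block_norm N (block_apply N T v) \<le> (\<Sum>i<N. norm (block_apply N T v i))"
    unfolding block_norm_def by (rule L2_set_le_sum) auto
  ultimately show ?thesis
    by (simp add: power2_eq_square mult.assoc)
qed

lemma block_apply_scaleR:
  assumes "\<And>i j. i < N \<Longrightarrow> j < N \<Longrightarrow> linear (T i j)"
  shows "i < N \<Longrightarrow> block_apply N T (\<lambda>j. r *\<^sub>R v j) i = r *\<^sub>R block_apply N T v i"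
  by (simp add: block_apply_def assms linear_cmul scaleR_sum_right)

lemma block_norm_scaleR: "block_norm N (\<lambda>j. r *\<^sub>R v j) = \<bar>r\<bar> * block_norm N v"
  by (simp add: block_norm_def L2_set_right_distrib)

lemma block_norm_cong: "(\<And>i. i < N \<Longrightarrow> v i = w i) \<Longrightarrow> block_norm N v = block_norm N w"
  unfolding block_norm_def by (rule L2_set_cong) auto

section \<open>Operator norms of block operators\<close>

lemma block_op_norm_alt:
  "block_op_norm N T = Sup ((\<lambda>v. block_norm N (block_apply N T v)) ` {v. block_norm N v \<le> 1})"
  by (simp add: block_op_norm_def block_norm_def block_apply_def image_Collect)

lemma block_unit_ball_nonempty: "(\<lambda>_. 0) \<in> {v. block_norm N v \<le> 1}"
  by (simp add: block_norm_def L2_set_def)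

lemma block_op_norm_le:
  assumes "\<And>v. block_norm N v \<le> 1 \<Longrightarrow> block_norm N (block_apply N T v) \<le> C"
  shows "block_op_norm N T \<le> C"
  unfolding block_op_norm_alt using block_unit_ball_nonempty assms
  by (intro cSUP_least) blast+

lemma less_block_op_norm:
  assumes "t < block_op_norm N T"
  obtains v where "block_norm N v \<le> 1" "t < block_norm N (block_apply N T v)"
  using assms block_op_norm_le[of N T t] by (meson not_less)

text \<open>A real \<open>Sup\<close> bounds its elements only when the set is bounded above; the
  crude estimate supplies that on the unit ball, and rescaling v to norm one does the rest.\<close>

lemma block_norm_apply:
  fixes T :: "nat \<Rightarrow> nat \<Rightarrow> 'v \<Rightarrow> 'v::real_normed_vector"
  assumes T: "\<And>i j. i < N \<Longrightarrow> j < N \<Longrightarrow> bounded_linear (T i j)"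
  shows "block_norm N (block_apply N T v) \<le> block_op_norm N T * block_norm N v"
proof -
  \<comment> \<open>The sum of all entry norms dominates each of them and, unlike a maximum, is also
    defined for N = 0.\<close>
  define c where "c = (\<Sum>i<N. \<Sum>j<N. onorm (T i j))"
  have on: "0 \<le> onorm (T i j)" if "i < N" "j < N" for i j
    using that T onorm_pos_le by blast
  have c: "0 \<le> c"
    unfolding c_def using on by (intro sum_nonneg) auto
  have bd: "norm (T i j z) \<le> c * norm z" if "i < N" "j < N" for i j z
  proof -
    have "onorm (T i j) \<le> (\<Sum>j<N. onorm (T i j))"
      using that on by (intro member_le_sum) auto
    also have "\<dots> \<le> c"
      unfolding c_def using that on
      by (intro member_le_sum[where f = "\<lambda>i. \<Sum>j<N. onorm (T i j)"] sum_nonneg) auto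
    finally show ?thesis
      using onorm[OF T[OF that], of z] by (meson mult_right_mono norm_ge_zero order_trans)
  qed
  have ball: "block_norm N (block_apply N T w) \<le> block_op_norm N T" if "block_norm N w \<le> 1" for w
    unfolding block_op_norm_alt
  proof (rule cSUP_upper)
    show "bdd_above ((\<lambda>v. block_norm N (block_apply N T v)) ` {v. block_norm N v \<le> 1})"
    proof (rule bdd_aboveI2)
      fix v :: "nat \<Rightarrow> 'v" assume "v \<in> {v. block_norm N v \<le> 1}"
      then show "block_norm N (block_apply N T v) \<le> (real N)\<^sup>2 * c * 1"
        using c by (intro order_trans[OF block_norm_apply_le[OF bd c]] mult_left_mono) auto
    qed
  qed (use that in simp)
  show ?thesis
  proof (cases "block_norm N v = 0")
    \<comment> \<open>Such a v cannot be normalised, but the crude bound already forces its image to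
      have norm 0.\<close>
    case True
    then show ?thesis
      using block_norm_apply_le[of N T c v, OF bd c] by simp
  next
    case False
    define r where "r = inverse (block_norm N v)"
    have r: "0 < r" "r * block_norm N v = 1"
      using False block_norm_nonneg[of N v] unfolding r_def by (simp_all add: less_le)
    have "r * block_norm N (block_apply N T v) = block_norm N (block_apply N T (\<lambda>j. r *\<^sub>R v j))"
      using block_norm_cong[OF block_apply_scaleR[of N T _ r v]] T r
      by (simp add: block_norm_scaleR bounded_linear.linear)
    also have "\<dots> \<le> block_op_norm N T"
      using r by (intro ball) (simp add: block_norm_scaleR)
    finally show ?thesis
      using r by (simp add: r_def field_simps False)
  qed
qed

section \<open>Matrices over the function algebra\<close>

abbreviation eval_matrix ::
  "(nat \<Rightarrow> nat \<Rightarrow> ('x::topological_space \<Rightarrow>\<^sub>C complex)) \<Rightarrow> 'x \<Rightarrow> nat \<Rightarrow> nat \<Rightarrow> complex \<Rightarrow> complex"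
  where "eval_matrix F x \<equiv> \<lambda>i j z. apply_bcontfun (F i j) x * z"

text \<open>The supremum over x needs an upper bound uniform in x; the supremum norms of the entries
  provide one.\<close>

lemma block_op_norm_eval_le: "block_op_norm N (eval_matrix F x) \<le> fun_matrix_norm N F"
  unfolding fun_matrix_norm_def
proof (rule cSUP_upper)
  define c where "c = (\<Sum>i<N. \<Sum>j<N. norm (F i j))"
  have c: "0 \<le> c"
    unfolding c_def by (intro sum_nonneg) auto
  have bd: "norm (eval_matrix F x i j z) \<le> c * norm z" if "i < N" "j < N" for i j z x
  proof -
    have "norm (apply_bcontfun (F i j) x) \<le> norm (F i j)"
      by (rule norm_bounded)
    also have "norm (F i j) \<le> (\<Sum>j<N. norm (F i j))"
      using that by (intro member_le_sum) auto
    also have "\<dots> \<le> c"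
      unfolding c_def using that
      by (intro member_le_sum[where f = "\<lambda>i. \<Sum>j<N. norm (F i j)"] sum_nonneg) auto
    finally show ?thesis
      by (simp add: norm_mult mult_right_mono)
  qed
  show "bdd_above (range (\<lambda>x. block_op_norm N (eval_matrix F x)))"
  proof (rule bdd_aboveI2, rule block_op_norm_le)
    fix x and v :: "nat \<Rightarrow> complex" assume "block_norm N v \<le> 1"
    then show "block_norm N (block_apply N (eval_matrix F x) v) \<le> (real N)\<^sup>2 * c * 1"
      using c by (intro order_trans[OF block_norm_apply_le[OF bd c]] mult_left_mono) auto
  qed
qed simp

lemma block_norm_eval_le:
  "block_norm N (block_apply N (eval_matrix F x) v) \<le> fun_matrix_norm N F * block_norm N v"
proof -
  have "block_norm N (block_apply N (eval_matrix F x) v)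
      \<le> block_op_norm N (eval_matrix F x) * block_norm N v"
    by (rule block_norm_apply) (rule bounded_linear_mult_right)
  also have "\<dots> \<le> fun_matrix_norm N F * block_norm N v"
    by (intro mult_right_mono block_op_norm_eval_le) simp
  finally show ?thesis .
qed

lemma fun_matrix_norm_le:
  assumes "\<And>x v. block_norm N v \<le> 1 \<Longrightarrow> block_norm N (block_apply N (eval_matrix F x) v) \<le> C"
  shows "fun_matrix_norm N F \<le> C"
  unfolding fun_matrix_norm_def by (intro cSUP_least block_op_norm_le assms) auto

text \<open>The entry is a component of the image of the j-th standard basis vector
  \<open>?e\<close>, which has norm one.\<close>

lemma norm_entry_le_fun_matrix_norm:
  assumes "i < N" "j < N"
  shows "cmod (apply_bcontfun (F i j) x) \<le> fun_matrix_norm N F"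
proof -
  let ?e = "\<lambda>k. if k = j then 1 else 0 :: complex"
  have "block_inner N ?e ?e = (\<Sum>k<N. if k = j then 1 else 0)"
    unfolding block_inner_def by (intro sum.cong) auto
  then have "(block_norm N ?e)\<^sup>2 = 1"
    using assms by (simp add: block_norm_power2)
  then have "block_norm N ?e = 1"
    using block_norm_nonneg[of N ?e] by (simp add: power2_eq_1_iff)
  moreover have "block_apply N (eval_matrix F x) ?e i = apply_bcontfun (F i j) x"
    using assms by (simp add: block_apply_def if_distrib cong: if_cong)
  ultimately show ?thesis
    using block_norm_eval_le[of N F x ?e]
      norm_le_block_norm[OF assms(1), of "block_apply N (eval_matrix F x) ?e"]
    by simp
qed


lemma block_apply_diff:
  assumes "\<And>i j. i < N \<Longrightarrow> j < N \<Longrightarrow> linear (T i j)" "i < N"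
  shows "block_apply N T (\<lambda>j. v j - w j) i = block_apply N T v i - block_apply N T w i"
  using assms by (simp add: block_apply_def linear_diff sum_subtractf)

lemma block_inner_cong:
  "(\<And>i. i < N \<Longrightarrow> v i = v' i) \<Longrightarrow> (\<And>i. i < N \<Longrightarrow> w i = w' i)
    \<Longrightarrow> block_inner N v w = block_inner N v' w'"
  unfolding block_inner_def by (rule sum.cong) auto

lemma block_norm_le_iff: "0 \<le> c \<Longrightarrow> block_norm N v \<le> c \<longleftrightarrow> block_inner N v v \<le> c\<^sup>2"
  by (metis block_norm_power2 block_norm_nonneg abs_le_square_iff abs_of_nonneg)

section \<open>Representations of the algebra and their amplifications\<close>

text \<open>One interface for point evaluations, on \<open>complex\<close>, and for \<theta>, on
  \<open>complex^'n\<close>: the Moebius computation is needed in both. The space is only a real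
  one, so complex scalars act through \<open>sc\<close>.\<close>

locale block_representation =
  fixes A :: "('x::t2_space \<Rightarrow>\<^sub>C complex) set"
    and sc :: "complex \<Rightarrow> 'v::real_inner \<Rightarrow> 'v"
    and \<rho> :: "('x \<Rightarrow>\<^sub>C complex) \<Rightarrow> 'v \<Rightarrow> 'v"
  assumes A: "uniform_algebra A"
    and sc_linear: "linear (sc c)"
    and sc_uminus: "sc (- c) z = - sc c z"
    and norm_sc: "norm (sc c z) = cmod c * norm z"
    and sc_adjoint: "sc c z \<bullet> w = z \<bullet> sc (cnj c) w"
    and rep_linear: "f \<in> A \<Longrightarrow> bounded_linear (\<rho> f)"
    and rep_add: "f \<in> A \<Longrightarrow> g \<in> A \<Longrightarrow> \<rho> (f + g) z = \<rho> f z + \<rho> g z"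
    and rep_mult: "f \<in> A \<Longrightarrow> g \<in> A \<Longrightarrow> \<rho> (f * g) z = \<rho> f (\<rho> g z)"
    and rep_scale: "f \<in> A \<Longrightarrow> \<rho> (const_bcontfun c * f) z = sc c (\<rho> f z)"
    and rep_one: "\<rho> 1 z = z"

context block_representation
begin

lemma const_mem: "const_bcontfun c \<in> A"
  using A by (auto simp: uniform_algebra_def)

lemma add_mem: "f \<in> A \<Longrightarrow> g \<in> A \<Longrightarrow> f + g \<in> A"
  and mult_mem: "f \<in> A \<Longrightarrow> g \<in> A \<Longrightarrow> f * g \<in> A"
  using A by (auto simp: uniform_algebra_def)

lemma zero_mem: "0 \<in> A"
  using const_mem[of 0] by (metis bcontfun_eqI const_bcontfun.rep_eq zero_bcontfun.rep_eq)

lemma one_mem: "1 \<in> A"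
  using const_mem[of 1] by (simp add: one_bcontfun_def)

lemma rep_const: "\<rho> (const_bcontfun c) z = sc c z"
  using rep_scale[OF one_mem, of c z] by (simp add: rep_one)

text \<open>Scalars are the images of constant functions, and these commute with f in the
  algebra.\<close>

lemma rep_sc:
  assumes "f \<in> A" shows "\<rho> f (sc c z) = sc c (\<rho> f z)"
  using rep_mult[OF assms const_mem, of c z] rep_scale[OF assms, of c z]
  by (simp add: rep_const mult.commute)

lemma rep_zero: "\<rho> 0 z = 0"
  using rep_add[OF zero_mem zero_mem, of z] by simp

lemma sum_mem: "(\<And>k. k \<in> S \<Longrightarrow> f k \<in> A) \<Longrightarrow> sum f S \<in> A"
  by (induction S rule: infinite_finite_induct) (auto simp: zero_mem add_mem)

lemma rep_sum: "(\<And>k. k \<in> S \<Longrightarrow> f k \<in> A) \<Longrightarrow> \<rho> (sum f S) z = (\<Sum>k\<in>S. \<rho> (f k) z)"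
  by (induction S rule: infinite_finite_induct) (auto simp: rep_zero rep_add sum_mem)

definition rep_block :: "nat \<Rightarrow> (nat \<Rightarrow> nat \<Rightarrow> ('x \<Rightarrow>\<^sub>C complex)) \<Rightarrow> (nat \<Rightarrow> 'v) \<Rightarrow> nat \<Rightarrow> 'v"
  where "rep_block N F = block_apply N (\<lambda>i j. \<rho> (F i j))"

definition sc_block :: "nat \<Rightarrow> (nat \<Rightarrow> nat \<Rightarrow> complex) \<Rightarrow> (nat \<Rightarrow> 'v) \<Rightarrow> nat \<Rightarrow> 'v"
  where "sc_block N B = block_apply N (\<lambda>i j. sc (B i j))"

end

section \<open>First order Moebius transform and near-extremal vectors\<close>

definition adj :: "(nat \<Rightarrow> nat \<Rightarrow> complex) \<Rightarrow> nat \<Rightarrow> nat \<Rightarrow> complex"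
  where "adj B = (\<lambda>i j. cnj (B j i))"

text \<open>The Moebius transform \<open>F + B - F B\<^sup>* F\<close> of \<open>F\<close>, to first order in \<open>B\<close>.\<close>

definition perturbed ::
  "nat \<Rightarrow> (nat \<Rightarrow> nat \<Rightarrow> ('x::topological_space \<Rightarrow>\<^sub>C complex)) \<Rightarrow> (nat \<Rightarrow> nat \<Rightarrow> complex) \<Rightarrow>
    nat \<Rightarrow> nat \<Rightarrow> ('x \<Rightarrow>\<^sub>C complex)"
  where "perturbed N F B = (\<lambda>i j. F i j + (const_bcontfun (B i j) +
    (\<Sum>k<N. \<Sum>l<N. const_bcontfun (- adj B k l) * (F i k * F l j))))"

context block_representation
begin

context
  fixes N and F :: "nat \<Rightarrow> nat \<Rightarrow> ('x \<Rightarrow>\<^sub>C complex)"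
  assumes F: "\<And>i j. i < N \<Longrightarrow> j < N \<Longrightarrow> F i j \<in> A"
begin

lemma perturbed_mem: "i < N \<Longrightarrow> j < N \<Longrightarrow> perturbed N F B i j \<in> A"
  unfolding perturbed_def by (intro add_mem F const_mem sum_mem mult_mem) auto

text \<open>As \<rho> is multiplicative and unital, the formula F + B - F B^* F passes from
  functions to operators; scalars are moved past \<rho> by \<open>rep_sc\<close>.\<close>

lemma rep_block_perturbed:
  assumes "i < N"
  shows "rep_block N (perturbed N F B) v i =
    rep_block N F v i + sc_block N B v i - rep_block N F (sc_block N (adj B) (rep_block N F v)) i"
proof -
  have lin: "\<rho> f (sum g S) = (\<Sum>k\<in>S. \<rho> f (g k))" if "f \<in> A" for f and g :: "nat \<Rightarrow> 'v" and S
    using bounded_linear.linear[OF rep_linear[OF that]] by (rule linear_sum)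
  have "\<rho> (perturbed N F B i j) z = \<rho> (F i j) z + sc (B i j) z -
      (\<Sum>k<N. \<Sum>l<N. \<rho> (F i k) (sc (adj B k l) (\<rho> (F l j) z)))" if "j < N" for j z
  proof -
    let ?h = "\<lambda>k l. const_bcontfun (- adj B k l) * (F i k * F l j)"
    have h: "?h k l \<in> A" if "k < N" "l < N" for k l
      using F \<open>i < N\<close> \<open>j < N\<close> that by (intro mult_mem const_mem) auto
    have "\<rho> (\<Sum>k<N. \<Sum>l<N. ?h k l) z = (\<Sum>k<N. \<rho> (\<Sum>l<N. ?h k l) z)"
      by (rule rep_sum) (auto intro!: sum_mem h)
    also have "\<dots> = (\<Sum>k<N. \<Sum>l<N. \<rho> (?h k l) z)"
      by (intro sum.cong refl rep_sum) (auto intro: h)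
    also have "\<dots> = (\<Sum>k<N. \<Sum>l<N. - \<rho> (F i k) (sc (adj B k l) (\<rho> (F l j) z)))"
      using F \<open>i < N\<close> \<open>j < N\<close>
      by (intro sum.cong refl) (simp add: rep_scale rep_mult mult_mem sc_uminus rep_sc)
    finally have "\<rho> (\<Sum>k<N. \<Sum>l<N. ?h k l) z
      = - (\<Sum>k<N. \<Sum>l<N. \<rho> (F i k) (sc (adj B k l) (\<rho> (F l j) z)))"
      by (simp add: sum_negf)
    moreover have "(\<Sum>k<N. \<Sum>l<N. ?h k l) \<in> A"
      by (auto intro!: sum_mem h)
    ultimately show ?thesis
      using F \<open>i < N\<close> \<open>j < N\<close>
      by (simp add: perturbed_def rep_add add_mem const_mem rep_const)
  qed
  then have "rep_block N (perturbed N F B) v i = rep_block N F v i + sc_block N B v i -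
      (\<Sum>j<N. \<Sum>k<N. \<Sum>l<N. \<rho> (F i k) (sc (adj B k l) (\<rho> (F l j) (v j))))"
    by (simp add: rep_block_def sc_block_def block_apply_def sum.distrib sum_subtractf)
  \<comment> \<open>The column index j is moved innermost, where linearity collects the sum over j
    into the components of \<open>rep_block N F v\<close>.\<close>
  also have "(\<Sum>j<N. \<Sum>k<N. \<Sum>l<N. \<rho> (F i k) (sc (adj B k l) (\<rho> (F l j) (v j))))
      = (\<Sum>k<N. \<Sum>j<N. \<Sum>l<N. \<rho> (F i k) (sc (adj B k l) (\<rho> (F l j) (v j))))"
    by (rule sum.swap)
  also have "\<dots> = (\<Sum>k<N. \<Sum>l<N. \<Sum>j<N. \<rho> (F i k) (sc (adj B k l) (\<rho> (F l j) (v j))))"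
    by (intro sum.cong refl sum.swap)
  also have "\<dots> = rep_block N F (sc_block N (adj B) (rep_block N F v)) i"
    unfolding rep_block_def sc_block_def block_apply_def
    using F \<open>i < N\<close> by (intro sum.cong refl) (simp add: lin linear_sum[OF sc_linear])
  finally show ?thesis .
qed

lemma block_norm_rep_block_scale:
  "block_norm N (rep_block N (\<lambda>i j. const_bcontfun c * F i j) v)
    = cmod c * block_norm N (rep_block N F v)"
proof -
  have "rep_block N (\<lambda>i j. const_bcontfun c * F i j) v i = sc c (rep_block N F v i)" if "i < N" for i
    using F that by (simp add: rep_block_def block_apply_def rep_scale linear_sum[OF sc_linear])
  then have "block_norm N (rep_block N (\<lambda>i j. const_bcontfun c * F i j) v)
      = L2_set (\<lambda>i. cmod c * norm (rep_block N F v i)) {..<N}"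
    unfolding block_norm_def by (intro L2_set_cong) (simp_all add: norm_sc)
  then show ?thesis
    by (simp add: block_norm_def L2_set_right_distrib)
qed

lemma sc_block_adjoint: "block_inner N (sc_block N B v) w = block_inner N v (sc_block N (adj B) w)"
  unfolding sc_block_def adj_def by (rule block_inner_adjoint) (simp add: sc_adjoint)

lemma block_norm_sc_block:
  assumes "\<And>i j. i < N \<Longrightarrow> j < N \<Longrightarrow> cmod (B i j) \<le> c" "0 \<le> c"
  shows "block_norm N (sc_block N B v) \<le> (real N)\<^sup>2 * c * block_norm N v"
  unfolding sc_block_def using assms
  by (intro block_norm_apply_le) (auto simp: norm_sc mult_right_mono)

text \<open>Write the transformed vector as F(v - q) + a with q = B^* F v and a = B v. Contractivity
  bounds |F(v - q)| by |v - q|, and the first order terms of the two squares cancel, leaving errors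
  quadratic in b.\<close>

lemma block_norm_perturbed:
  assumes contr: "\<And>v. block_norm N (rep_block N F v) \<le> block_norm N v"
    and B: "\<And>i j. i < N \<Longrightarrow> j < N \<Longrightarrow> cmod (B i j) \<le> c" and "0 \<le> c" and b: "b = (real N)\<^sup>2 * c"
  shows "block_norm N (rep_block N (perturbed N F B) v) \<le> (1 + 2 * b\<^sup>2) * block_norm N v"
proof -
  define p where "p = rep_block N F v"
  define q where "q = sc_block N (adj B) p"
  define a where "a = sc_block N B v"
  define r where "r = rep_block N F q"
  define n where "n = block_norm N v"
  have n: "0 \<le> n" "0 \<le> b" using \<open>0 \<le> c\<close> by (simp_all add: n_def b)
  have p: "block_norm N p \<le> n" unfolding p_def n_def by (rule contr)
  have a: "block_norm N a \<le> b * n"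
    unfolding a_def n_def b by (rule block_norm_sc_block) (use B \<open>0 \<le> c\<close> in auto)
  have "block_norm N q \<le> b * block_norm N p"
    unfolding q_def b by (rule block_norm_sc_block) (use B \<open>0 \<le> c\<close> in \<open>auto simp: adj_def\<close>)
  also have "\<dots> \<le> b * n" using p n by (intro mult_left_mono)
  finally have q: "block_norm N q \<le> b * n" .
  have r: "block_norm N r \<le> b * n" unfolding r_def using contr q order_trans by blast
  have sq: "block_inner N a a \<le> (b * n)\<^sup>2" "block_inner N q q \<le> (b * n)\<^sup>2"
    using a q n by (simp_all flip: block_norm_le_iff)
  have "\<bar>block_inner N r a\<bar> \<le> block_norm N r * block_norm N a"
    by (rule block_inner_Cauchy_Schwarz)
  also have "\<dots> \<le> (b * n) * (b * n)" using a r n by (intro mult_mono) auto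
  finally have ra: "- block_inner N r a \<le> (b * n)\<^sup>2" by (simp add: power2_eq_square)
  have "block_norm N (\<lambda>i. p i - r i) = block_norm N (rep_block N F (\<lambda>i. v i - q i))"
    unfolding p_def r_def rep_block_def
    by (rule block_norm_cong, rule block_apply_diff[symmetric])
      (use F rep_linear bounded_linear.linear in blast)+
  also have "\<dots> \<le> block_norm N (\<lambda>i. v i - q i)"
    by (rule contr)
  finally have "(block_norm N (\<lambda>i. p i - r i))\<^sup>2 \<le> (block_norm N (\<lambda>i. v i - q i))\<^sup>2"
    by (simp add: power_mono)
  then have pr: "block_inner N (\<lambda>i. p i - r i) (\<lambda>i. p i - r i)
      \<le> n\<^sup>2 - 2 * block_inner N v q + block_inner N q q"
    by (simp add: block_norm_power2 n_def block_inner_commute)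
  \<comment> \<open>This is the cancellation: the term -2 <v, q> from |v - q|^2 meets +2 <p, a> from
    the cross term with a.\<close>
  have vq: "block_inner N v q = block_inner N p a"
    unfolding q_def a_def by (metis sc_block_adjoint block_inner_commute)
  have "(block_norm N (rep_block N (perturbed N F B) v))\<^sup>2
      = (block_norm N (\<lambda>i. (p i - r i) + a i))\<^sup>2"
    by (rule arg_cong[where f = "\<lambda>x. x\<^sup>2"], rule block_norm_cong)
      (simp add: rep_block_perturbed p_def r_def q_def a_def)
  also have "\<dots> = block_inner N (\<lambda>i. p i - r i) (\<lambda>i. p i - r i)
      + 2 * (block_inner N p a - block_inner N r a) + block_inner N a a"
    by (simp add: block_norm_power2 block_inner_commute)
  also have "\<dots> \<le> n\<^sup>2 + 4 * (b * n)\<^sup>2"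
    unfolding vq[symmetric] using add_mono[OF pr add_mono[OF sq(1) mult_left_mono[OF ra, of 2]]] sq(2)
    by (simp add: algebra_simps)
  \<comment> \<open>The added term completes the square of (1 + 2 b^2) n.\<close>
  also have "\<dots> \<le> n\<^sup>2 + 4 * (b * n)\<^sup>2 + (2 * b\<^sup>2 * n)\<^sup>2"
    by simp
  also have "\<dots> = ((1 + 2 * b\<^sup>2) * n)\<^sup>2"
    by (simp add: power2_eq_square algebra_simps)
  finally show ?thesis
    unfolding n_def[symmetric] by (rule power2_le_imp_le) (use n in simp)
qed

text \<open>
  If \<open>T = \<rho>(F)\<close> almost attains the norm bound \<open>K\<close> at \<open>x\<close>, then \<open>T\<^sup>* T x\<close> is almost \<open>K\<^sup>2 x\<close>, so
  that the first order term of \<open>\<langle>\<rho>(F + B - F B\<^sup>* F) x, T x\<rangle>\<close> is almost \<open>(1 - K\<^sup>2) \<langle>B x, T x\<rangle>\<close>.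
\<close>

lemma near_extremal:
  assumes adjoint: "\<And>f z w. f \<in> A \<Longrightarrow> \<rho> f z \<bullet> w = z \<bullet> \<rho>' f w"
    and K: "\<And>v. block_norm N (rep_block N F v) \<le> K * block_norm N v" "0 \<le> K"
    and G: "\<And>v. block_norm N (rep_block N (perturbed N F B) v) \<le> K * (1 + 2 * b\<^sup>2) * block_norm N v"
    and B: "\<And>i j. i < N \<Longrightarrow> j < N \<Longrightarrow> cmod (B i j) \<le> c" and "0 \<le> c" and b: "b = (real N)\<^sup>2 * c"
    and x: "block_norm N x \<le> 1" and u: "u = rep_block N F x"
    and \<sigma>: "K\<^sup>2 - (block_norm N u)\<^sup>2 \<le> \<sigma>\<^sup>2" "0 \<le> \<sigma>"
  shows "- (K\<^sup>2 - 1) * block_inner N (sc_block N B x) u \<le> \<sigma>\<^sup>2 + 2 * K\<^sup>2 * b\<^sup>2 + b * K\<^sup>2 * \<sigma>"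
proof -
  define T' where "T' = block_apply N (\<lambda>i j. \<rho>' (F j i))"
  define t where "t = block_norm N u"
  have T': "block_inner N (rep_block N F v) w = block_inner N v (T' w)" for v w
    unfolding rep_block_def T'_def by (rule block_inner_adjoint) (use F adjoint in auto)
  have "0 \<le> b" using \<open>0 \<le> c\<close> by (simp add: b)
  have t: "0 \<le> t" "t \<le> K"
    using K(1)[of x] mult_left_mono[OF x K(2)] by (auto simp: t_def u)
  \<comment> \<open>The adjoint inherits the bound K: apply Cauchy-Schwarz to |T' w|^2 = <T T' w, w>
    and cancel one factor |T' w|.\<close>
  have T'_bound: "block_norm N (T' w) \<le> K * block_norm N w" for w
  proof -
    have "(block_norm N (T' w))\<^sup>2 = block_inner N (rep_block N F (T' w)) w"
      by (simp add: block_norm_power2 T')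
    also have "\<dots> \<le> block_norm N (rep_block N F (T' w)) * block_norm N w"
      using block_inner_Cauchy_Schwarz abs_le_D1 by blast
    also have "\<dots> \<le> K * block_norm N (T' w) * block_norm N w"
      by (intro mult_right_mono K) simp
    finally have "block_norm N (T' w) * block_norm N (T' w)
        \<le> block_norm N (T' w) * (K * block_norm N w)"
      by (simp add: power2_eq_square mult_ac)
    then show ?thesis
      using K(2) by (cases "block_norm N (T' w) = 0") (auto simp: less_le mult_le_cancel_left)
  qed
  \<comment> \<open>The defect of x as an eigenvector of T^* T for K^2. Expanding, |e|^2 is at most
    K^2 t^2 - 2 K^2 t^2 + K^4 = K^2 (K^2 - t^2).\<close>
  define e where "e = (\<lambda>i. T' u i - K\<^sup>2 *\<^sub>R x i)"
  have "block_inner N x (T' u) = t\<^sup>2"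
    using T'[of x u] by (simp add: u[symmetric] t_def block_norm_power2)
  moreover have "block_inner N (T' u) (T' u) \<le> K\<^sup>2 * t\<^sup>2"
    using T'_bound[of u] K(2) by (simp add: block_norm_le_iff t_def power_mult_distrib)
  moreover have "K\<^sup>2 * (K\<^sup>2 * block_inner N x x) \<le> K\<^sup>2 * (K\<^sup>2 * 1)"
    using x by (intro mult_left_mono) (simp_all add: block_norm_le_iff)
  ultimately have "block_inner N e e \<le> K\<^sup>2 * (K\<^sup>2 - t\<^sup>2)"
    unfolding e_def by (simp add: block_inner_commute[of N "T' u" x] algebra_simps)
  also have "\<dots> \<le> (K * \<sigma>)\<^sup>2"
    using \<sigma> by (simp add: t_def power_mult_distrib mult_left_mono)
  finally have e: "block_norm N e \<le> K * \<sigma>"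
    using K \<sigma> by (simp add: block_norm_le_iff)
  define q where "q = sc_block N (adj B) u"
  have "block_norm N q \<le> b * t"
    unfolding q_def b t_def
    by (rule block_norm_sc_block) (use B \<open>0 \<le> c\<close> in \<open>auto simp: adj_def\<close>)
  also have "\<dots> \<le> b * K" using t \<open>0 \<le> b\<close> by (intro mult_left_mono)
  finally have "block_norm N q * block_norm N e \<le> (b * K) * (K * \<sigma>)"
    using e K(2) \<open>0 \<le> b\<close> by (intro mult_mono) auto
  then have qe: "block_inner N q e \<le> b * K\<^sup>2 * \<sigma>"
    using block_inner_Cauchy_Schwarz[of N q e] by (simp add: power2_eq_square mult_ac)
  have qx: "block_inner N q x = block_inner N (sc_block N B x) u"
    unfolding q_def by (metis sc_block_adjoint block_inner_commute)
  have "block_inner N (rep_block N (perturbed N F B) x) u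
      = block_inner N (\<lambda>i. u i + sc_block N B x i - rep_block N F q i) u"
    by (rule block_inner_cong) (simp_all add: rep_block_perturbed u q_def)
  also have "\<dots> = t\<^sup>2 + block_inner N (sc_block N B x) u - block_inner N q (T' u)"
    by (simp add: T' t_def block_norm_power2)
  \<comment> \<open>Replacing T' u by K^2 x + e produces the factor 1 - K^2, since <q, x> = <B x,
    u>.\<close>
  also have "block_inner N q (T' u) = block_inner N q e + K\<^sup>2 * block_inner N q x"
    unfolding e_def by simp
  finally have eq: "block_inner N (rep_block N (perturbed N F B) x) u
      = t\<^sup>2 - (K\<^sup>2 - 1) * block_inner N (sc_block N B x) u - block_inner N q e"
    by (simp add: qx algebra_simps)
  \<comment> \<open>Extremality enters here: by \<open>G\<close> the perturbed matrix cannot exceed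
    K by more than a second order factor.\<close>
  have "block_inner N (rep_block N (perturbed N F B) x) u
      \<le> block_norm N (rep_block N (perturbed N F B) x) * t"
    using block_inner_Cauchy_Schwarz abs_le_D1 unfolding t_def by blast
  also have "\<dots> \<le> (K * (1 + 2 * b\<^sup>2) * 1) * K"
    using t K(2) order_trans[OF G[of x] mult_left_mono[OF x]] by (intro mult_mono) auto
  finally have "- (K\<^sup>2 - 1) * block_inner N (sc_block N B x) u
      \<le> K\<^sup>2 - t\<^sup>2 + 2 * K\<^sup>2 * b\<^sup>2 + block_inner N q e"
    unfolding eq by (simp add: algebra_simps power2_eq_square)
  then show ?thesis
    using qe \<sigma>(1) by (simp add: t_def)
qed

end

end


section \<open>Point evaluations and \<theta> as representations\<close>

lemma block_representation_eval:
  fixes A :: "('x::t2_space \<Rightarrow>\<^sub>C complex) set"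
  assumes "uniform_algebra A"
  shows "block_representation A (*) (\<lambda>f z. apply_bcontfun f x * z)"
proof (rule block_representation.intro)
  show "linear ((*) c)" for c :: complex
    by (rule bounded_linear.linear) (rule bounded_linear_mult_right)
  show "bounded_linear ((*) (apply_bcontfun f x))" for f :: "'x \<Rightarrow>\<^sub>C complex"
    by (rule bounded_linear_mult_right)
qed (use assms in \<open>auto simp: norm_mult algebra_simps inner_complex_def\<close>)

lemma map_matrix_mult_vector: "map_matrix ((*) c) M *v z = c *s (M *v z)"
  by (simp add: vec_eq_iff matrix_vector_mult_def map_matrix_def sum_distrib_left mult.assoc)

lemma norm_vector_scalar_mult:
  fixes z :: "complex^'n"
  shows "norm (c *s z) = cmod c * norm z"
  by (simp add: norm_vec_def norm_mult L2_set_right_distrib)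

lemma linear_vector_scalar_mult: "linear ((*s) c :: complex^'n \<Rightarrow> complex^'n)"
  by (rule linearI) (simp_all add: vec_eq_iff algebra_simps)

lemma inner_vector_scalar_mult:
  fixes z w :: "complex^'n"
  shows "(c *s z) \<bullet> w = z \<bullet> (cnj c *s w)"
  by (simp add: inner_vec_def inner_complex_def algebra_simps)

lemma inner_conj_transpose:
  fixes M :: "complex^'n^'m"
  shows "(M *v z) \<bullet> w = z \<bullet> (conj_transpose M *v w)"
proof -
  have "(M *v z) \<bullet> w = (\<Sum>i\<in>UNIV. \<Sum>j\<in>UNIV. (M $ i $ j * z $ j) \<bullet> (w $ i))"
    by (simp add: inner_vec_def matrix_vector_mult_def inner_sum_left)
  also have "\<dots> = (\<Sum>j\<in>UNIV. \<Sum>i\<in>UNIV. (M $ i $ j * z $ j) \<bullet> (w $ i))"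
    by (rule sum.swap)
  also have "\<dots> = (\<Sum>j\<in>UNIV. \<Sum>i\<in>UNIV. (z $ j) \<bullet> (cnj (M $ i $ j) * w $ i))"
    by (intro sum.cong refl) (simp add: inner_complex_def algebra_simps)
  finally show ?thesis
    by (simp add: inner_vec_def matrix_vector_mult_def inner_sum_right conj_transpose_def
        map_matrix_def transpose_def)
qed

lemma block_representation_hom:
  fixes \<theta> :: "('x::t2_space \<Rightarrow>\<^sub>C complex) \<Rightarrow> complex^'n^'n"
  assumes "uniform_algebra A" "unital_algebra_hom_on A \<theta>"
  shows "block_representation A (*s) (\<lambda>f z. \<theta> f *v z)"
proof (rule block_representation.intro)
  show "linear ((*s) c :: complex^'n \<Rightarrow> complex^'n)" for c
    by (rule linear_vector_scalar_mult)
  show "(- c) *s z = - (c *s z)" for c and z :: "complex^'n"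
    by (simp add: vec_eq_iff)
qed (use assms in \<open>auto simp: unital_algebra_hom_on_def norm_vector_scalar_mult
      inner_vector_scalar_mult map_matrix_mult_vector matrix_vector_mul_assoc
      matrix_vector_mult_add_rdistrib\<close>)

text \<open>A unital homomorphism maps constants to scalar matrices, whose adjoints carry the
  conjugate scalar. For the constant \<alpha>(f) this makes the second term of \<Lambda>(f) a
  scalar.\<close>

lemma conj_transpose_hom_const:
  fixes \<theta> :: "('x::t2_space \<Rightarrow>\<^sub>C complex) \<Rightarrow> complex^'n^'n"
  assumes "uniform_algebra A" "unital_algebra_hom_on A \<theta>"
  shows "conj_transpose (\<theta> (const_bcontfun c)) *v z = cnj c *s z"
proof -
  interpret block_representation A "(*s)" "\<lambda>f z. \<theta> f *v z"
    by (rule block_representation_hom[OF assms])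
  have "(conj_transpose (\<theta> (const_bcontfun c)) *v z) \<bullet> w = (cnj c *s z) \<bullet> w" for w
    by (metis inner_conj_transpose inner_commute rep_const inner_vector_scalar_mult)
  then show ?thesis
    by (metis vector_eq_rdot)
qed

section \<open>Operator bounds from amplification norms\<close>

lemma amplification_norm_bound:
  assumes "amplification_norm A \<nu> \<phi> N \<le> ennreal K" "0 \<le> K"
    and "\<And>i j. i < N \<Longrightarrow> j < N \<Longrightarrow> F i j \<in> A" "fun_matrix_norm N F \<le> 1"
  shows "\<nu> N (\<lambda>i j. \<phi> (F i j)) \<le> K"
proof -
  have "ennreal (\<nu> N (\<lambda>i j. \<phi> (F i j))) \<le> amplification_norm A \<nu> \<phi> N"
    unfolding amplification_norm_def using assms by (intro SUP_upper) auto
  then have "ennreal (\<nu> N (\<lambda>i j. \<phi> (F i j))) \<le> ennreal K"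
    using assms(1) by (rule order_trans)
  then show ?thesis
    using assms(2) by (simp add: ennreal_le_iff)
qed

lemma amplification_norm_le_cb_norm: "1 \<le> N \<Longrightarrow> amplification_norm A \<nu> \<phi> N \<le> cb_norm A \<nu> \<phi>"
  unfolding cb_norm_def by (rule SUP_upper) simp

lemma block_norm_mat_apply_le:
  fixes M :: "nat \<Rightarrow> nat \<Rightarrow> complex^'n^'n"
  shows "block_norm N (block_apply N (\<lambda>i j z. M i j *v z) v) \<le> mat_matrix_norm N M * block_norm N v"
  unfolding mat_matrix_norm_def by (rule block_norm_apply) simp

text \<open>Dividing F by C puts it in the unit ball over which the amplification norm is taken. The
  use is with C = 1 for F and C = 1 + 2 b^2 for its Moebius transform.\<close>

lemma hom_matrix_bound:
  fixes \<theta> :: "('x::t2_space \<Rightarrow>\<^sub>C complex) \<Rightarrow> complex^'n^'n"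
  assumes A: "uniform_algebra A" and \<theta>: "unital_algebra_hom_on A \<theta>"
    and K: "amplification_norm A mat_matrix_norm \<theta> N \<le> ennreal K" "0 \<le> K"
    and F: "\<And>i j. i < N \<Longrightarrow> j < N \<Longrightarrow> F i j \<in> A"
    and C: "\<And>x v. block_norm N (block_apply N (eval_matrix F x) v) \<le> C * block_norm N v" "0 < C"
  shows "block_norm N (block_apply N (\<lambda>i j z. \<theta> (F i j) *v z) v) \<le> K * C * block_norm N v"
proof -
  let ?c = "complex_of_real (1 / C)"
  let ?F = "\<lambda>i j. const_bcontfun ?c * F i j"
  have scale: "block_norm N (block_apply N (eval_matrix ?F x) v)
      = (1 / C) * block_norm N (block_apply N (eval_matrix F x) v)" for x v
    using block_representation.block_norm_rep_block_scale[OF block_representation_eval[OF A] F,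
        where c = ?c and v = v] C(2)
    by (simp add: block_representation.rep_block_def[OF block_representation_eval[OF A]] norm_divide)
  have "fun_matrix_norm N ?F \<le> 1"
  proof (rule fun_matrix_norm_le)
    fix x and v :: "nat \<Rightarrow> complex" assume "block_norm N v \<le> 1"
    then have "block_norm N (block_apply N (eval_matrix F x) v) \<le> C * 1"
      using C(2) by (intro order_trans[OF C(1)] mult_left_mono) auto
    then show "block_norm N (block_apply N (eval_matrix ?F x) v) \<le> 1"
      unfolding scale using C(2) by (simp add: pos_divide_le_eq)
  qed
  moreover have "?F i j \<in> A" if "i < N" "j < N" for i j
    using A F[OF that] unfolding uniform_algebra_def by blast
  ultimately have "mat_matrix_norm N (\<lambda>i j. \<theta> (?F i j)) \<le> K"
    using amplification_norm_bound[OF K, of ?F] by blast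
  then have "block_norm N (block_apply N (\<lambda>i j z. \<theta> (?F i j) *v z) v) \<le> K * block_norm N v"
    by (intro order_trans[OF block_norm_mat_apply_le] mult_right_mono) auto
  moreover have "block_norm N (block_apply N (\<lambda>i j z. \<theta> (?F i j) *v z) v)
      = (1 / C) * block_norm N (block_apply N (\<lambda>i j z. \<theta> (F i j) *v z) v)"
    using block_representation.block_norm_rep_block_scale[OF block_representation_hom[OF A \<theta>] F,
        where c = ?c and v = v] C(2)
    by (simp add: block_representation.rep_block_def[OF block_representation_hom[OF A \<theta>]] norm_divide)
  ultimately have "(1 / C) * block_norm N (block_apply N (\<lambda>i j z. \<theta> (F i j) *v z) v)
      \<le> K * block_norm N v"
    by (simp only:)
  then show ?thesis
    using C(2) by (simp add: pos_divide_le_eq mult_ac)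
qed

section \<open>The extremal argument\<close>

text \<open>With B of size \<sigma> = sqrt (K^2 - t^2), the first order term is linear in \<sigma>,
  while the extremality gap, the Moebius error and the defect of x are all multiples of \<sigma>^2.
  Dividing by \<sigma> leaves a right side that vanishes as t tends to K.\<close>

lemma extremal_estimate:
  fixes \<theta> :: "('x::t2_space \<Rightarrow>\<^sub>C complex) \<Rightarrow> complex^'n^'n"
  assumes A: "uniform_algebra A" and \<theta>: "unital_algebra_hom_on A \<theta>"
    and \<alpha>: "\<And>f. f \<in> A \<Longrightarrow> \<alpha> f = const_bcontfun (a f)"
    and \<alpha>_contr: "amplification_norm A fun_matrix_norm \<alpha> N \<le> 1"
    and \<Lambda>: "amplification_norm A mat_matrix_norm (\<lambda>f. \<theta> f + conj_transpose (\<theta> (\<alpha> f))) N \<le> 2"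
    and K: "amplification_norm A mat_matrix_norm \<theta> N = ennreal K"
    and t: "1 \<le> t" "t < K"
  shows "(K\<^sup>2 - 1) * (t\<^sup>2 - 2 * t)
    \<le> sqrt (K\<^sup>2 - t\<^sup>2) * (1 + 2 * K\<^sup>2 * ((real N)\<^sup>2)\<^sup>2 + (real N)\<^sup>2 * K\<^sup>2)"
proof -
  interpret block_representation A "(*s)" "\<lambda>f z. \<theta> f *v z"
    by (rule block_representation_hom[OF A \<theta>])
  have "0 \<le> K" using t by simp
  have "ennreal t < amplification_norm A mat_matrix_norm \<theta> N"
    using t by (simp add: K ennreal_less_iff)
  then obtain F where F: "\<And>i j. i < N \<Longrightarrow> j < N \<Longrightarrow> F i j \<in> A" "fun_matrix_norm N F \<le> 1"
    and "t < mat_matrix_norm N (\<lambda>i j. \<theta> (F i j))"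
    using t unfolding amplification_norm_def less_SUP_iff by (auto simp: ennreal_less_iff)
  then obtain x where x: "block_norm N x \<le> 1" and
    tx: "t < block_norm N (block_apply N (\<lambda>i j z. \<theta> (F i j) *v z) x)"
    unfolding mat_matrix_norm_def using less_block_op_norm by metis
  define u where "u = rep_block N F x"
  define \<tau> where "\<tau> = block_norm N u"
  have \<tau>: "t < \<tau>" using tx by (simp add: \<tau>_def u_def rep_block_def)
  define \<sigma> where "\<sigma> = sqrt (K\<^sup>2 - t\<^sup>2)"
  have "t\<^sup>2 < K\<^sup>2" using t by (intro power_strict_mono) auto
  then have \<sigma>: "0 < \<sigma>" "\<sigma>\<^sup>2 = K\<^sup>2 - t\<^sup>2" by (simp_all add: \<sigma>_def)
  define b0 where "b0 = (real N)\<^sup>2"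
  \<comment> \<open>The amplified scalar function phi at F; the conjugate comes from the adjoint in
    \<Lambda>.\<close>
  define B0 where "B0 = (\<lambda>i j. cnj (a (F i j)))"
  define B where "B = (\<lambda>i j. complex_of_real \<sigma> * B0 i j)"
  define P where "P = block_inner N (sc_block N B0 x) u"

  have "fun_matrix_norm N (\<lambda>i j. \<alpha> (F i j)) \<le> 1"
    using amplification_norm_bound[of A fun_matrix_norm \<alpha> N 1 F] \<alpha>_contr F by simp
  then have "cmod (a (F i j)) \<le> 1" if "i < N" "j < N" for i j
    using norm_entry_le_fun_matrix_norm[OF that, of "\<lambda>i j. \<alpha> (F i j)"] \<alpha>[OF F(1)[OF that]]
    by (metis const_bcontfun.rep_eq order_trans)
  then have B: "cmod (B i j) \<le> \<sigma>" if "i < N" "j < N" for i j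
    using that \<sigma>(1) by (simp add: B_def B0_def norm_mult mult_left_le)

  have contr: "block_norm N (block_apply N (eval_matrix F y) v) \<le> 1 * block_norm N v" for y v
    using F(2) by (intro order_trans[OF block_norm_eval_le] mult_right_mono) auto
  \<comment> \<open>Each point evaluation is contractive on F, so the Moebius bound holds at every
    y; the amplified \<theta> then carries it over with the factor K.\<close>
  have "block_norm N (block_apply N (eval_matrix (perturbed N F B) y) v)
      \<le> (1 + 2 * (b0 * \<sigma>)\<^sup>2) * block_norm N v" for y v
    using block_representation.block_norm_perturbed[OF block_representation_eval[OF A, where x = y] F(1) _ B,
        where v = v and b = "b0 * \<sigma>"] contr \<sigma>(1)
    by (simp add: block_representation.rep_block_def[OF block_representation_eval[OF A]] b0_def)
  then have G: "block_norm N (rep_block N (perturbed N F B) v)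
      \<le> K * (1 + 2 * (b0 * \<sigma>)\<^sup>2) * block_norm N v" for v
    unfolding rep_block_def
    by (intro hom_matrix_bound[OF A \<theta>]) (auto simp: K \<open>0 \<le> K\<close> perturbed_mem F add_pos_nonneg)
  have T: "block_norm N (rep_block N F v) \<le> K * block_norm N v" for v
    using hom_matrix_bound[OF A \<theta> _ \<open>0 \<le> K\<close> F(1) contr, of v] by (simp add: K rep_block_def)
  have gap: "K\<^sup>2 - (block_norm N u)\<^sup>2 \<le> \<sigma>\<^sup>2"
    using \<tau> t by (simp add: \<sigma>(2) \<tau>_def power_mono)
  have "- (K\<^sup>2 - 1) * block_inner N (sc_block N B x) u
      \<le> \<sigma>\<^sup>2 + 2 * K\<^sup>2 * (b0 * \<sigma>)\<^sup>2 + b0 * \<sigma> * K\<^sup>2 * \<sigma>"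
    by (rule near_extremal[OF F(1) inner_conj_transpose T \<open>0 \<le> K\<close> G B _ _ x u_def gap])
      (use \<sigma>(1) in \<open>simp_all add: b0_def\<close>)
  also have "block_inner N (sc_block N B x) u = \<sigma> * P"
  proof -
    have "sc_block N B x i = \<sigma> *\<^sub>R sc_block N B0 x i" for i
      by (simp add: sc_block_def block_apply_def B_def vec_eq_iff
          scaleR_conv_of_real[where 'a = complex] sum_distrib_left mult.assoc)
    then have "sc_block N B x = (\<lambda>i. \<sigma> *\<^sub>R sc_block N B0 x i)" by (rule ext)
    then show ?thesis by (simp add: P_def)
  qed
  finally have "\<sigma> * (- (K\<^sup>2 - 1) * P) \<le> \<sigma> * (\<sigma> * (1 + 2 * K\<^sup>2 * b0\<^sup>2 + b0 * K\<^sup>2))"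
    by (simp add: power2_eq_square algebra_simps)
  then have "- (K\<^sup>2 - 1) * P \<le> \<sigma> * (1 + 2 * K\<^sup>2 * b0\<^sup>2 + b0 * K\<^sup>2)"
    using \<sigma>(1) mult_le_cancel_left_pos by blast
  \<comment> \<open>As K > 1, this bounds -P by a multiple of \<sigma>: P is almost
    nonnegative.\<close>
  then have P: "(K\<^sup>2 - 1) * (- P) \<le> \<sigma> * (1 + 2 * K\<^sup>2 * b0\<^sup>2 + b0 * K\<^sup>2)"
    by (simp add: algebra_simps)

  \<comment> \<open>The amplified \<Lambda> at F sends x to u + B0 x; pairing with u gives \<tau>^2
    + P on one side and at most 2 \<tau> on the other.\<close>
  let ?\<Lambda> = "\<lambda>i j. \<theta> (F i j) + conj_transpose (\<theta> (\<alpha> (F i j)))"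
  have "mat_matrix_norm N ?\<Lambda> \<le> 2"
    using amplification_norm_bound[where \<phi> = "\<lambda>f. \<theta> f + conj_transpose (\<theta> (\<alpha> f))" and K = 2] \<Lambda> F
    by simp
  then have "block_norm N (block_apply N (\<lambda>i j z. ?\<Lambda> i j *v z) x) \<le> 2 * 1"
    using x by (intro order_trans[OF block_norm_mat_apply_le] mult_mono) auto
  then have "block_norm N (block_apply N (\<lambda>i j z. ?\<Lambda> i j *v z) x) * \<tau> \<le> 2 * \<tau>"
    using \<tau> t by (intro mult_right_mono) auto
  then have "block_inner N (block_apply N (\<lambda>i j z. ?\<Lambda> i j *v z) x) u \<le> 2 * \<tau>"
    using abs_le_D1[OF block_inner_Cauchy_Schwarz] order_trans unfolding \<tau>_def by blast
  moreover have "block_inner N (block_apply N (\<lambda>i j z. ?\<Lambda> i j *v z) x) u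
      = block_inner N (\<lambda>i. u i + sc_block N B0 x i) u"
    by (rule block_inner_cong)
      (simp_all add: u_def rep_block_def sc_block_def block_apply_def matrix_vector_mult_add_rdistrib
        sum.distrib \<alpha> F conj_transpose_hom_const[OF A \<theta>] B0_def)
  ultimately have "\<tau>\<^sup>2 - 2 * \<tau> \<le> - P"
    by (simp add: \<tau>_def block_norm_power2 P_def)
  \<comment> \<open>Since s^2 - 2 s = (s - 1)^2 - 1 increases for s at least 1, \<tau> can be
    replaced by the smaller t.\<close>
  moreover have "(t - 1)\<^sup>2 \<le> (\<tau> - 1)\<^sup>2"
    using \<tau> t by (intro power_mono) auto
  ultimately have "t\<^sup>2 - 2 * t \<le> - P"
    by (simp add: power2_diff)
  moreover have "0 \<le> K\<^sup>2 - 1" using t by simp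
  ultimately have "(K\<^sup>2 - 1) * (t\<^sup>2 - 2 * t) \<le> (K\<^sup>2 - 1) * (- P)"
    by (intro mult_left_mono)
  then show ?thesis
    using P by (simp add: \<sigma>_def b0_def)
qed

theorem mainTheorem2:
  fixes A :: "('x::t2_space \<Rightarrow>\<^sub>C complex) set"
    and \<alpha> :: "('x \<Rightarrow>\<^sub>C complex) \<Rightarrow> ('x \<Rightarrow>\<^sub>C complex)"
    and \<theta> :: "('x \<Rightarrow>\<^sub>C complex) \<Rightarrow> complex^'n^'n"
  assumes "uniform_algebra A"
    and "antilinear_on A \<alpha>"
    and "complete_contraction A fun_matrix_norm \<alpha>"
    and "\<alpha> ` A \<subseteq> range const_bcontfun"
    and "unital_algebra_hom_on A \<theta>"
    and "continuous_on A \<theta>"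
    and "completely_bounded A mat_matrix_norm \<theta>"
    and "cb_norm A mat_matrix_norm (\<lambda>f. \<theta> f + conj_transpose (\<theta> (\<alpha> f))) \<le> 2"
  shows "cb_norm A mat_matrix_norm \<theta> \<le> 2"
proof -
  have "\<forall>f\<in>A. \<exists>c. \<alpha> f = const_bcontfun c"
    using assms(4) by blast
  then obtain a where a: "\<And>f. f \<in> A \<Longrightarrow> \<alpha> f = const_bcontfun (a f)"
    by metis
  have "amplification_norm A mat_matrix_norm \<theta> N \<le> 2" if "1 \<le> N" for N
  proof (rule ccontr)
    assume gt: "\<not> amplification_norm A mat_matrix_norm \<theta> N \<le> 2"
    \<comment> \<open>Complete boundedness makes the norm at level N a real number K, which can then
      be approached from below by real t.\<close>
    have "amplification_norm A mat_matrix_norm \<theta> N < \<infinity>"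
      using assms(7) amplification_norm_le_cb_norm[OF that]
      unfolding completely_bounded_def by (rule le_less_trans[rotated])
    then obtain K where K: "amplification_norm A mat_matrix_norm \<theta> N = ennreal K" "0 \<le> K"
      by (cases "amplification_norm A mat_matrix_norm \<theta> N") auto
    have "2 < K"
      using gt K(2) ennreal_le_iff[of 2 K] ennreal_leI[of K 2] unfolding K(1) by fastforce
    define C where "C = 1 + 2 * K\<^sup>2 * ((real N)\<^sup>2)\<^sup>2 + (real N)\<^sup>2 * K\<^sup>2"
    have \<alpha>: "amplification_norm A fun_matrix_norm \<alpha> N \<le> 1"
      using assms(3) amplification_norm_le_cb_norm[OF that] order_trans
      unfolding complete_contraction_def by blast
    have \<Lambda>: "amplification_norm A mat_matrix_norm (\<lambda>f. \<theta> f + conj_transpose (\<theta> (\<alpha> f))) N \<le> 2"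
      using assms(8) amplification_norm_le_cb_norm[OF that] order_trans by blast
    have le: "(K\<^sup>2 - 1) * (t\<^sup>2 - 2 * t) \<le> sqrt (K\<^sup>2 - t\<^sup>2) * C" if "1 \<le> t" "t < K" for t
      unfolding C_def by (rule extremal_estimate[OF assms(1,5) a \<alpha> \<Lambda> K(1) that])
    \<comment> \<open>The estimate needs t < K, so K is reached as a left limit. There the right
      side is 0, while K > 2 makes the left side positive.\<close>
    have "(K\<^sup>2 - 1) * (K\<^sup>2 - 2 * K) \<le> sqrt (K\<^sup>2 - K\<^sup>2) * C"
    proof (rule tendsto_le)
      show "((\<lambda>t. (K\<^sup>2 - 1) * (t\<^sup>2 - 2 * t)) \<longlongrightarrow> (K\<^sup>2 - 1) * (K\<^sup>2 - 2 * K)) (at_left K)"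
        "((\<lambda>t. sqrt (K\<^sup>2 - t\<^sup>2) * C) \<longlongrightarrow> sqrt (K\<^sup>2 - K\<^sup>2) * C) (at_left K)"
        by (intro tendsto_intros)+
      show "\<forall>\<^sub>F t in at_left K. (K\<^sup>2 - 1) * (t\<^sup>2 - 2 * t) \<le> sqrt (K\<^sup>2 - t\<^sup>2) * C"
        unfolding eventually_at_left_field using le \<open>2 < K\<close> by (intro exI[of _ 1]) auto
    qed simp
    moreover have "0 < (K\<^sup>2 - 1) * (K\<^sup>2 - 2 * K)"
      using \<open>2 < K\<close> by (intro mult_pos_pos) (auto simp: power2_eq_square less_1_mult)
    ultimately show False by simp
  qed
  then show ?thesis
    unfolding cb_norm_def by (intro SUP_least) simp
qed

end
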